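(* Let $A$ be an ordered semiring. Then the set $\mathrm{Rad}(A)$ of all radical ideals of $A$, ordered by inclusion, is a spatial frame.
   Context: Semirings are commutative and unital: $(A,0,+)$ and $(A,1,\cdot)$ are commutative monoids with $x\cdot 0=0$ and $x(y+z)=xy+xz$. An ordered semiring is a tuple $(A,\leq,0,1,+,\cdot)$ where $(A,0,1,+,\cdot)$ is a semiring and $\leq$ is a preorder on $A$ with respect to which $+$ and $\cdot$ are monotone. An ideal of an ordered semiring $A$ is a subset $I\subseteq A$ such that: $x\leq y\in I$ implies $x\in I$; $0\in I$; $x,y\in I$ implies $x+y\in I$; and if $x\in I$ or $y\in I$ then $xy\in I$. An ideal $I$ is radical if for all $x\in A$ and $n\in\mathbb{N}$, $x^n\in I$ implies $x\in I$. A frame is a complete lattice $(F,\leq)$ in which $x\wedge\bigvee_\lambda y_\lambda=\bigvee_\lambda (x\wedge y_\lambda)$ for all $x\in F$ and all families $(y_\lambda)$. A frame is spatial if it is isomorphic to the frame $\mathcal{O}(X)$ of open sets of some topological space $X$. *)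

theory Defs
  imports "HOL-Algebra.Complete_Lattice" "HOL-Algebra.Ring" "HOL-Analysis.Abstract_Topology"
begin

section \<open>Ordered semirings and their radical ideals\<close>

record 'a ord_ring = "'a ring" +
  ole :: "'a \<Rightarrow> 'a \<Rightarrow> bool"  (infixl \<open>\<preceq>\<index>\<close> 50)

text \<open>
  Neither antisymmetry of the order nor \<open>\<zero> \<preceq> \<one>\<close> nor \<open>\<zero> \<noteq> \<one>\<close> is required.
\<close>

locale ord_semiring = semiring A + comm_monoid A
  for A :: "('a, 'm) ord_ring_scheme" (structure) +
  assumes ole_refl: "x \<in> carrier A \<Longrightarrow> x \<preceq> x"
    and ole_trans:
      "\<lbrakk>x \<preceq> y; y \<preceq> z; x \<in> carrier A; y \<in> carrier A; z \<in> carrier A\<rbrakk> \<Longrightarrow> x \<preceq> z"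
    and add_mono:
      "\<lbrakk>x \<preceq> x'; y \<preceq> y'; x \<in> carrier A; x' \<in> carrier A; y \<in> carrier A; y' \<in> carrier A\<rbrakk>
        \<Longrightarrow> x \<oplus> y \<preceq> x' \<oplus> y'"
    and mult_mono:
      "\<lbrakk>x \<preceq> x'; y \<preceq> y'; x \<in> carrier A; x' \<in> carrier A; y \<in> carrier A; y' \<in> carrier A\<rbrakk>
        \<Longrightarrow> x \<otimes> y \<preceq> x' \<otimes> y'"

locale ord_ideal =
  fixes I :: "'a set" and A :: "('a, 'm) ord_ring_scheme" (structure)
  assumes ideal_subset: "I \<subseteq> carrier A"
    and down_closed: "\<lbrakk>x \<in> carrier A; x \<preceq> y; y \<in> I\<rbrakk> \<Longrightarrow> x \<in> I"
    and zero_mem: "\<zero> \<in> I"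
    and add_mem: "\<lbrakk>x \<in> I; y \<in> I\<rbrakk> \<Longrightarrow> x \<oplus> y \<in> I"
    and mult_mem: "\<lbrakk>x \<in> carrier A; y \<in> carrier A; x \<in> I \<or> y \<in> I\<rbrakk> \<Longrightarrow> x \<otimes> y \<in> I"

locale radical_ord_ideal = ord_ideal +
  assumes radical: "\<And>x n::nat. \<lbrakk>x \<in> carrier A; x [^] n \<in> I\<rbrakk> \<Longrightarrow> x \<in> I"

definition Rad :: "('a, 'm) ord_ring_scheme \<Rightarrow> 'a set gorder"
  where "Rad A = \<lparr>carrier = {I. radical_ord_ideal I A}, eq = (=), le = (\<subseteq>)\<rparr>"


section \<open>Frames\<close>

text \<open>
  Only the image of a family matters for its join, so the families in the distributive law
  are given as subsets of the carrier.
\<close>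

locale frame = complete_lattice L for L (structure) +
  assumes meet_Sup_distrib:
    "\<lbrakk>x \<in> carrier L; Y \<subseteq> carrier L\<rbrakk> \<Longrightarrow> x \<sqinter> \<Squnion>Y = \<Squnion>((\<lambda>y. x \<sqinter> y) ` Y)"

definition opens :: "'a topology \<Rightarrow> 'a set gorder"
  where "opens X = \<lparr>carrier = {U. openin X U}, eq = (=), le = (\<subseteq>)\<rparr>"

definition order_isomorphism ::
  "('a, 'c) gorder_scheme \<Rightarrow> ('b, 'd) gorder_scheme \<Rightarrow> ('a \<Rightarrow> 'b) \<Rightarrow> bool"
  where "order_isomorphism L M f \<longleftrightarrow> order_emb L M f \<and> bij_betw f (carrier L) (carrier M)"

text \<open>
  HOL cannot quantify over all types inside a formula, so the points of the space are taken
  from the type of the elements of the lattice. This loses no generality: the lemma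
  \<open>spatial_frameI\<close> below allows a space over any type.
\<close>

definition spatial_frame :: "('a, 'c) gorder_scheme \<Rightarrow> bool"
  where "spatial_frame L \<longleftrightarrow>
    frame L \<and> (\<exists>(X :: 'a topology) f. order_isomorphism L (opens X) f)"

text \<open>
  The space in the definition is the Kolmogorov quotient of the given one, each point \<open>x\<close>
  being represented by the lattice element of the largest open set avoiding \<open>x\<close>.
\<close>

lemma spatial_frameI:
  fixes L :: "('a, 'c) gorder_scheme" and X :: "'b topology"
  assumes "frame L" and f: "order_isomorphism L (opens X) f"
  shows "spatial_frame L"
proof -
  define N where "N x = \<Union>{U. openin X U \<and> x \<notin> U}" for x
  define e where "e x = inv_into (carrier L) f (N x)" for x
  have bij: "bij_betw f (carrier L) {U. openin X U}" and emb: "order_emb L (opens X) f"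
    using f by (auto simp: order_isomorphism_def opens_def)
  have "openin X (N x)" for x
    unfolding N_def by auto
  then have fe: "f (e x) = N x" for x
    unfolding e_def using bij by (simp add: bij_betw_inv_into_right)
  have sat: "y \<in> U" if "openin X U" "x \<in> U" "e x = e y" for x y U
  proof (rule ccontr)
    assume "y \<notin> U"
    then have "x \<in> N y" using that unfolding N_def by auto
    moreover have "N y = N x" using fe[of x] fe[of y] that(3) by simp
    ultimately show False unfolding N_def by auto
  qed
  have e_sub: "e ` U \<subseteq> e ` V \<longleftrightarrow> U \<subseteq> V" if "openin X V" for U V
  proof
    assume *: "e ` U \<subseteq> e ` V"
    show "U \<subseteq> V"
    proof
      fix x assume "x \<in> U"
      then have "e x \<in> e ` V" using * by blast
      then obtain y where "y \<in> V" "e x = e y" by blast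
      then show "x \<in> V" using sat[OF that, of y x] by simp
    qed
  qed auto
  have e_Int: "e ` U \<inter> e ` V = e ` (U \<inter> V)" if "openin X U" "openin X V" for U V
  proof
    show "e ` U \<inter> e ` V \<subseteq> e ` (U \<inter> V)"
    proof
      fix z assume "z \<in> e ` U \<inter> e ` V"
      then obtain x y where "x \<in> U" "z = e x" "y \<in> V" "z = e y" by blast
      then show "z \<in> e ` (U \<inter> V)" using sat[OF that(2), of y x] by auto
    qed
  qed auto
  define opn where "opn W \<longleftrightarrow> (\<exists>U. openin X U \<and> W = e ` U)" for W
  have "istopology opn"
    unfolding istopology_def
  proof (intro conjI allI impI)
    fix S T assume "opn S" "opn T"
    then obtain U V where "openin X U" "openin X V" "S = e ` U" "T = e ` V"
      unfolding opn_def by blast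
    then show "opn (S \<inter> T)"
      unfolding opn_def using e_Int[of U V] openin_Int[of X U V] by auto
  next
    fix K assume K: "\<forall>S\<in>K. opn S"
    have "\<Union>K = e ` \<Union>{U. openin X U \<and> e ` U \<in> K}"
    proof
      show "\<Union>K \<subseteq> e ` \<Union>{U. openin X U \<and> e ` U \<in> K}"
      proof
        fix z assume "z \<in> \<Union>K"
        then obtain W where W: "W \<in> K" "z \<in> W" by blast
        then obtain U where "openin X U" "W = e ` U" using K unfolding opn_def by blast
        then show "z \<in> e ` \<Union>{U. openin X U \<and> e ` U \<in> K}" using W by blast
      qed
    qed auto
    moreover have "openin X (\<Union>{U. openin X U \<and> e ` U \<in> K})" by auto
    ultimately show "opn (\<Union>K)" unfolding opn_def by blast
  qed
  then have top: "openin (topology opn) = opn" by simp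
  have "inj_on (\<lambda>U. e ` U) {U. openin X U}"
  proof (rule inj_onI)
    fix U V assume "U \<in> {U. openin X U}" "V \<in> {U. openin X U}" "e ` U = e ` V"
    then show "U = V" using e_sub[of U V] e_sub[of V U] by auto
  qed
  moreover have "(\<lambda>U. e ` U) ` {U. openin X U} = {W. opn W}"
    unfolding opn_def by auto
  ultimately have "bij_betw ((\<lambda>U. e ` U) \<circ> f) (carrier L) {W. opn W}"
    by (intro bij_betw_trans[OF bij]) (simp add: bij_betw_def)
  moreover have "order_emb L (opens (topology opn)) ((\<lambda>U. e ` U) \<circ> f)"
    unfolding order_emb_def
  proof (intro conjI ballI)
    show "weak_partial_order L" using emb by (simp add: order_emb_def)
    show "weak_partial_order (opens (topology opn))"
      by standard (auto simp: opens_def)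
    fix x y assume xy: "x \<in> carrier L" "y \<in> carrier L"
    then have "openin X (f y)" using bij by (simp add: bij_betw_def) blast
    then show "((\<lambda>U. e ` U) \<circ> f) x \<sqsubseteq>\<^bsub>opens (topology opn)\<^esub> ((\<lambda>U. e ` U) \<circ> f) y
        \<longleftrightarrow> x \<sqsubseteq>\<^bsub>L\<^esub> y"
      using emb xy e_sub[of "f y" "f x"] by (simp add: order_emb_def opens_def)
  qed
  ultimately have "order_isomorphism L (opens (topology opn)) ((\<lambda>U. e ` U) \<circ> f)"
    by (simp add: order_isomorphism_def opens_def top)
  with \<open>frame L\<close> show ?thesis
    unfolding spatial_frame_def by blast
qed

end

theory Submission
  imports Defs
begin

text \<open>
  The points are the prime ideals. A radical ideal is the intersection of the primes above it:
  a radical ideal \<open>P\<close> maximal among those containing \<open>I\<close> and avoiding \<open>x\<close> is prime, because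
  for \<open>a b \<in> P\<close> with \<open>a \<notin> P\<close> and \<open>b \<notin> P\<close> the radical ideal \<open>(P : a)\<close> contains \<open>b\<close>, so it
  contains \<open>x\<close>; then \<open>(P : x)\<close> contains \<open>a\<close>, so it contains \<open>x\<close>, that is, \<open>x\<^sup>2 \<in> P\<close>.
  Hence joins of radical ideals can be tested on primes, and there both the frame law and the
  isomorphism with the open sets of the spectrum are immediate.
\<close>

section \<open>Prime ideals and the hull they define\<close>

locale prime_ord_ideal = ord_ideal +
  assumes one_notin: "\<one> \<notin> I"
    and prime: "\<lbrakk>x \<in> carrier A; y \<in> carrier A; x \<otimes> y \<in> I\<rbrakk> \<Longrightarrow> x \<in> I \<or> y \<in> I"

text \<open>Primality splits off one factor \<open>x\<close> at a time. For exponent 0 the premise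
  reads \<open>\<one> \<in> P\<close>, which \<open>one_notin\<close> excludes.\<close>

lemma (in ord_semiring) prime_imp_radical:
  assumes "prime_ord_ideal P A"
  shows "radical_ord_ideal P A"
proof -
  interpret prime_ord_ideal P A by fact
  show ?thesis
  proof
    fix x and n :: nat
    assume "x \<in> carrier A" "x [^] n \<in> P"
    then show "x \<in> P"
    proof (induction n)
      case 0
      then show ?case using one_notin by simp
    next
      case (Suc n)
      then show ?case using prime[of "x [^] n" x] by auto
    qed
  qed
qed

lemma radical_ord_ideal_Int:
  assumes "radical_ord_ideal I A" "radical_ord_ideal J A"
  shows "radical_ord_ideal (I \<inter> J) A"
proof -
  interpret I: radical_ord_ideal I A by fact
  interpret J: radical_ord_ideal J A by fact
  show ?thesis
  proof
    fix x and n :: nat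
    assume "x \<in> carrier A" "x [^]\<^bsub>A\<^esub> n \<in> I \<inter> J"
    then show "x \<in> I \<inter> J" using I.radical[of x n] J.radical[of x n] by simp
  qed (use I.ideal_subset I.down_closed J.down_closed I.zero_mem J.zero_mem I.add_mem J.add_mem
      I.mult_mem J.mult_mem in auto)
qed

text \<open>For \<open>S\<close> inside the carrier this turns out to be the radical ideal generated
  by \<open>S\<close>. Taking an intersection of primes replaces a description by elements; the
  bound \<open>carrier A\<close> is its value when no prime contains \<open>S\<close>.\<close>

definition prime_hull :: "('a, 'm) ord_ring_scheme \<Rightarrow> 'a set \<Rightarrow> 'a set"
  where "prime_hull A S = {x \<in> carrier A. \<forall>P. prime_ord_ideal P A \<longrightarrow> S \<subseteq> P \<longrightarrow> x \<in> P}"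

lemma prime_hull_superset: "S \<subseteq> carrier A \<Longrightarrow> S \<subseteq> prime_hull A S"
  unfolding prime_hull_def by blast

lemma prime_hull_mono: "S \<subseteq> T \<Longrightarrow> prime_hull A S \<subseteq> prime_hull A T"
  unfolding prime_hull_def by blast

lemma prime_hull_subset: "prime_ord_ideal P A \<Longrightarrow> S \<subseteq> P \<Longrightarrow> prime_hull A S \<subseteq> P"
  unfolding prime_hull_def by blast

context ord_semiring
begin

lemma radical_prime_hull: "radical_ord_ideal (prime_hull A S) A"
proof -
  have id: "ord_ideal P A" "radical_ord_ideal P A" if "prime_ord_ideal P A" for P
    using that prime_imp_radical by (auto simp: prime_ord_ideal_def)
  show ?thesis
  proof
    fix x y
    assume "x \<in> carrier A" "y \<in> carrier A" "x \<in> prime_hull A S \<or> y \<in> prime_hull A S"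
    then show "x \<otimes> y \<in> prime_hull A S"
      unfolding prime_hull_def using ord_ideal.mult_mem[OF id(1)] by simp blast
  next
    fix x y
    assume "x \<in> carrier A" "x \<preceq> y" "y \<in> prime_hull A S"
    then show "x \<in> prime_hull A S"
      unfolding prime_hull_def using ord_ideal.down_closed[OF id(1)] by simp
  next
    fix x and n :: nat
    assume "x \<in> carrier A" "x [^] n \<in> prime_hull A S"
    then show "x \<in> prime_hull A S"
      unfolding prime_hull_def using radical_ord_ideal.radical[OF id(2)] by simp blast
  qed (auto simp: prime_hull_def ord_ideal.zero_mem[OF id(1)] ord_ideal.add_mem[OF id(1)])
qed

section \<open>Colon ideals and the existence of primes\<close>

text \<open>Colon ideals are the competitors against which a maximal \<open>P\<close> is tested in
  \<open>ex_prime_avoiding\<close>, so they have to be radical again. Closure downwards comes from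
  monotonicity of multiplication by \<open>a\<close>.\<close>

lemma radical_colon:
  assumes "radical_ord_ideal P A" and a: "a \<in> carrier A"
  shows "radical_ord_ideal {y \<in> carrier A. y \<otimes> a \<in> P} A"
proof -
  interpret radical_ord_ideal P A by fact
  show ?thesis
  proof
    fix x y
    assume "x \<in> carrier A" "x \<preceq> y" "y \<in> {y \<in> carrier A. y \<otimes> a \<in> P}"
    then show "x \<in> {y \<in> carrier A. y \<otimes> a \<in> P}"
      using a down_closed[of "x \<otimes> a" "y \<otimes> a"] mult_mono[of x y a a] ole_refl by simp
  next
    fix x y
    assume "x \<in> carrier A" "y \<in> carrier A"
      and "x \<in> {y \<in> carrier A. y \<otimes> a \<in> P} \<or> y \<in> {y \<in> carrier A. y \<otimes> a \<in> P}"
    then show "x \<otimes> y \<in> {y \<in> carrier A. y \<otimes> a \<in> P}"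
      using a mult_mem[of "x \<otimes> a" y] mult_mem[of x "y \<otimes> a"] by (auto simp: m_ac)
  next
    fix x and n :: nat
    assume x: "x \<in> carrier A" and "x [^] n \<in> {y \<in> carrier A. y \<otimes> a \<in> P}"
    then have xn: "x [^] n \<otimes> a \<in> P" by simp
    \<comment> \<open>For n = 0 the hypothesis says that \<open>a\<close> itself lies in
      \<open>P\<close>. For n = k + 1 the power of \<open>x \<otimes> a\<close> is a multiple of
      \<open>x [^] n \<otimes> a\<close>, with k factors \<open>a\<close> left over.\<close>
    have "x \<otimes> a \<in> P"
    proof (cases n)
      case 0
      then show ?thesis using x a xn mult_mem[of x a] by simp
    next
      case (Suc k)
      then have "(x \<otimes> a) [^] n = (x [^] n \<otimes> a) \<otimes> a [^] k"
        using x a by (simp add: pow_mult_distrib m_comm m_ac)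
      then show ?thesis
        using radical[of "x \<otimes> a" n] mult_mem[of "x [^] n \<otimes> a" "a [^] k"] xn x a by simp
    qed
    with x show "x \<in> {y \<in> carrier A. y \<otimes> a \<in> P}" by simp
  qed (use a add_mem zero_mem in \<open>auto simp: l_distr\<close>)
qed

lemma ex_prime_avoiding:
  assumes I: "radical_ord_ideal I A" and x: "x \<in> carrier A" "x \<notin> I"
  shows "\<exists>P. prime_ord_ideal P A \<and> I \<subseteq> P \<and> x \<notin> P"
proof -
  let ?R = "{P. radical_ord_ideal P A \<and> I \<subseteq> P \<and> x \<notin> P}"
  have "\<exists>P\<in>?R. \<forall>Q\<in>?R. P \<subseteq> Q \<longrightarrow> Q = P"
  proof (rule subset_Zorn_nonempty)
    show "?R \<noteq> {}" using I x by blast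
  next
    fix C assume ne: "C \<noteq> {}" and C: "subset.chain ?R C"
    then have rad: "radical_ord_ideal P A" "ord_ideal P A" if "P \<in> C" for P
      using that unfolding subset_chain_def radical_ord_ideal_def by blast+
    have "radical_ord_ideal (\<Union>C) A"
    proof
      \<comment> \<open>Linearity of the chain puts both summands into one member; the other closure
        conditions involve a single member.\<close>
      fix u v assume "u \<in> \<Union>C" "v \<in> \<Union>C"
      then obtain P where "P \<in> C" "u \<in> P" "v \<in> P"
        using C unfolding subset_chain_def by blast
      then show "u \<oplus> v \<in> \<Union>C"
        using ord_ideal.add_mem[OF rad(2)] by blast
    next
      show "\<zero> \<in> \<Union>C" using ne ord_ideal.zero_mem[OF rad(2)] by blast
    next
      fix u and n :: nat assume "u \<in> carrier A" "u [^] n \<in> \<Union>C"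
      then show "u \<in> \<Union>C" using radical_ord_ideal.radical[OF rad(1)] by blast
    qed (use ord_ideal.ideal_subset[OF rad(2)] ord_ideal.down_closed[OF rad(2)]
        ord_ideal.mult_mem[OF rad(2)] in blast)+
    then show "\<Union>C \<in> ?R"
      using ne C unfolding subset_chain_def by blast
  qed
  then obtain P where "P \<in> ?R" and max': "\<forall>Q\<in>?R. P \<subseteq> Q \<longrightarrow> Q = P"
    by (rule bexE)
  then have P: "radical_ord_ideal P A" "I \<subseteq> P" "x \<notin> P" by simp_all
  have max: "Q = P" if "radical_ord_ideal Q A" "P \<subseteq> Q" "x \<notin> Q" for Q
    using max' that P(2) by simp
  interpret radical_ord_ideal P A by fact
  \<comment> \<open>The ideal (P : c) contains \<open>P\<close> and also \<open>d\<close>, which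
    lies outside \<open>P\<close>. Being strictly larger, it must contain \<open>x\<close> by
    maximality.\<close>
  have colon: "x \<otimes> c \<in> P" if c: "c \<in> carrier A" "d \<in> carrier A" "d \<otimes> c \<in> P" "d \<notin> P" for c d
  proof (rule ccontr)
    assume "x \<otimes> c \<notin> P"
    moreover have "P \<subseteq> {y \<in> carrier A. y \<otimes> c \<in> P}"
      using c ideal_subset mult_mem by blast
    ultimately have "{y \<in> carrier A. y \<otimes> c \<in> P} = P"
      using max[OF radical_colon[OF P(1) c(1)]] by simp
    then show False using c by blast
  qed
  have "prime_ord_ideal P A"
  proof
    show "\<one> \<notin> P" using mult_mem[of x \<one>] x P by auto
  next
    fix a b assume ab: "a \<in> carrier A" "b \<in> carrier A" "a \<otimes> b \<in> P"
    show "a \<in> P \<or> b \<in> P"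
    proof (rule ccontr)
      assume *: "\<not> (a \<in> P \<or> b \<in> P)"
      \<comment> \<open>\<open>colon\<close> is used twice: for the pair (a, b) here, and then for
        (x, a), whose premise is the membership just obtained.\<close>
      then have "a \<otimes> x \<in> P"
        using colon[of a b] ab x by (simp add: m_comm)
      then have "x \<otimes> x \<in> P"
        using colon[of x a] * ab x by simp
      then show False
        using radical[of x 2] x P by (simp add: numeral_2_eq_2)
    qed
  qed
  with P show ?thesis by blast
qed

text \<open>An element outside \<open>I\<close> is missed by some prime above \<open>I\<close>. With
  \<open>radical_prime_hull\<close>, the fixed points of the hull are exactly the radical
  ideals.\<close>

lemma prime_hull_radical:
  assumes "radical_ord_ideal I A"
  shows "prime_hull A I = I"
proof
  interpret radical_ord_ideal I A by fact
  show "I \<subseteq> prime_hull A I" using prime_hull_superset ideal_subset by blast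
  show "prime_hull A I \<subseteq> I"
    using ex_prime_avoiding[OF assms] unfolding prime_hull_def by blast
qed

lemma prime_hull_least:
  "radical_ord_ideal I A \<Longrightarrow> S \<subseteq> I \<Longrightarrow> prime_hull A S \<subseteq> I"
  using prime_hull_mono[of S I A] prime_hull_radical[of I] by simp

text \<open>Elements of \<open>I\<close> and \<open>J\<close> outside \<open>P\<close> would have a
  product in \<open>I \<inter> J\<close> but outside \<open>P\<close>. This lets binary meets be
  tested on primes.\<close>

lemma prime_Int_subset:
  assumes "prime_ord_ideal P A" "ord_ideal I A" "ord_ideal J A" "I \<inter> J \<subseteq> P"
  shows "I \<subseteq> P \<or> J \<subseteq> P"
proof (rule ccontr)
  assume "\<not> (I \<subseteq> P \<or> J \<subseteq> P)"
  then obtain x y where xy: "x \<in> I" "x \<notin> P" "y \<in> J" "y \<notin> P" by blast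
  then have c: "x \<in> carrier A" "y \<in> carrier A"
    using assms ord_ideal.ideal_subset by blast+
  then have "x \<otimes> y \<in> I \<inter> J"
    using xy ord_ideal.mult_mem[OF assms(2) c] ord_ideal.mult_mem[OF assms(3) c] by simp
  then show False
    using prime_ord_ideal.prime[OF assms(1) c] xy assms(4) by blast
qed

section \<open>Joins, meets and the frame law\<close>

lemma partial_order_Rad: "partial_order (Rad A)"
  by unfold_locales (auto simp: Rad_def)

lemma least_Upper_Rad:
  assumes "Y \<subseteq> carrier (Rad A)"
  shows "least (Rad A) (prime_hull A (\<Union>Y)) (Upper (Rad A) Y)"
proof -
  have "\<Union>Y \<subseteq> carrier A"
    using assms by (auto simp: Rad_def radical_ord_ideal_def dest: ord_ideal.ideal_subset)
  then have "\<forall>I\<in>Y. I \<subseteq> prime_hull A (\<Union>Y)"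
    using prime_hull_superset[of "\<Union>Y" A] by blast
  moreover have "Upper (Rad A) Y = {J. radical_ord_ideal J A \<and> (\<forall>I\<in>Y. I \<subseteq> J)}"
    using assms by (auto simp: Upper_def Rad_def)
  moreover have "prime_hull A (\<Union>Y) \<subseteq> J" if "radical_ord_ideal J A" "\<forall>I\<in>Y. I \<subseteq> J" for J
    using that by (intro prime_hull_least) auto
  ultimately show ?thesis
    unfolding least_def using radical_prime_hull by (simp add: Rad_def Collect_mono)
qed

text \<open>As a hull the meet is radical by \<open>radical_prime_hull\<close>, and
  \<open>prime_hull_least\<close> keeps it below each member of \<open>Y\<close>. The factor
  \<open>carrier A\<close> gives the right top element for empty \<open>Y\<close>, where
  \<open>\<Inter>Y\<close> is the whole type.\<close>

lemma greatest_Lower_Rad: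
  assumes "Y \<subseteq> carrier (Rad A)"
  shows "greatest (Rad A) (prime_hull A (carrier A \<inter> \<Inter>Y)) (Lower (Rad A) Y)"
proof -
  have sub: "J \<subseteq> prime_hull A (carrier A \<inter> \<Inter>Y)"
    if "radical_ord_ideal J A" "\<forall>I\<in>Y. J \<subseteq> I" for J
    using that prime_hull_mono[of J "carrier A \<inter> \<Inter>Y" A] prime_hull_radical[OF that(1)]
    by (auto simp: radical_ord_ideal_def dest: ord_ideal.ideal_subset)
  have "prime_hull A (carrier A \<inter> \<Inter>Y) \<subseteq> I" if "I \<in> Y" for I
    using that assms by (intro prime_hull_least) (auto simp: Rad_def)
  moreover have "Lower (Rad A) Y = {J. radical_ord_ideal J A \<and> (\<forall>I\<in>Y. J \<subseteq> I)}"
    using assms by (auto simp: Lower_def Rad_def)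
  ultimately show ?thesis
    unfolding greatest_def using radical_prime_hull sub by (simp add: Rad_def Collect_mono)
qed

lemma complete_lattice_Rad: "complete_lattice (Rad A)"
proof -
  interpret partial_order "Rad A" by (rule partial_order_Rad)
  show ?thesis
    by unfold_locales (use least_Upper_Rad greatest_Lower_Rad in blast)+
qed

lemma Sup_Rad:
  assumes "Y \<subseteq> carrier (Rad A)"
  shows "\<Squnion>\<^bsub>Rad A\<^esub>Y = prime_hull A (\<Union>Y)"
proof -
  interpret complete_lattice "Rad A" by (rule complete_lattice_Rad)
  show ?thesis
    using least_unique[OF sup_lub[OF assms] least_Upper_Rad[OF assms]] .
qed

lemma meet_Rad:
  assumes "radical_ord_ideal I A" "radical_ord_ideal J A"
  shows "I \<sqinter>\<^bsub>Rad A\<^esub> J = I \<inter> J"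
proof -
  interpret complete_lattice "Rad A" by (rule complete_lattice_Rad)
  have Y: "{I, J} \<subseteq> carrier (Rad A)" using assms by (simp add: Rad_def)
  have "greatest (Rad A) (I \<inter> J) (Lower (Rad A) {I, J})"
    using assms radical_ord_ideal_Int[OF assms] by (auto simp: greatest_def Lower_def Rad_def)
  then show ?thesis
    unfolding meet_def using greatest_unique[OF inf_glb[OF Y]] by blast
qed

lemma frame_Rad: "frame (Rad A)"
proof -
  interpret complete_lattice "Rad A" by (rule complete_lattice_Rad)
  show ?thesis
  proof
    fix I Y assume I: "I \<in> carrier (Rad A)" and Y: "Y \<subseteq> carrier (Rad A)"
    have rI: "radical_ord_ideal I A" and rY: "\<And>J. J \<in> Y \<Longrightarrow> radical_ord_ideal J A"
      using I Y by (auto simp: Rad_def)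
    have Y': "(\<lambda>J. I \<sqinter>\<^bsub>Rad A\<^esub> J) ` Y = (\<lambda>J. I \<inter> J) ` Y"
      using rI rY by (intro image_cong) (auto simp: meet_Rad)
    have "I \<inter> prime_hull A (\<Union>Y) = prime_hull A (\<Union>J\<in>Y. I \<inter> J)"
    proof
      show "prime_hull A (\<Union>J\<in>Y. I \<inter> J) \<subseteq> I \<inter> prime_hull A (\<Union>Y)"
        using prime_hull_least[OF rI, of "\<Union>J\<in>Y. I \<inter> J"]
          prime_hull_mono[of "\<Union>J\<in>Y. I \<inter> J" "\<Union>Y" A] by blast
      show "I \<inter> prime_hull A (\<Union>Y) \<subseteq> prime_hull A (\<Union>J\<in>Y. I \<inter> J)"
      proof
        fix x assume x: "x \<in> I \<inter> prime_hull A (\<Union>Y)"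
        \<comment> \<open>Such a prime contains \<open>I\<close>, hence \<open>x\<close>; or else,
          by \<open>prime_Int_subset\<close>, it contains every member of \<open>Y\<close>, hence
          the hull of their union.\<close>
        have "x \<in> P" if P: "prime_ord_ideal P A" "(\<Union>J\<in>Y. I \<inter> J) \<subseteq> P" for P
        proof (cases "I \<subseteq> P")
          case False
          have "J \<subseteq> P" if "J \<in> Y" for J
            using prime_Int_subset[OF P(1), of I J] rI rY[OF that] that P(2) False
            by (auto simp: radical_ord_ideal_def)
          then show ?thesis using x prime_hull_subset[OF P(1), of "\<Union>Y"] by blast
        qed (use x in blast)
        then show "x \<in> prime_hull A (\<Union>J\<in>Y. I \<inter> J)"
          using x by (simp add: prime_hull_def)
      qed
    qed
    moreover have "(\<lambda>J. I \<inter> J) ` Y \<subseteq> carrier (Rad A)"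
      using rI rY by (auto simp: Rad_def intro: radical_ord_ideal_Int)
    ultimately show "I \<sqinter>\<^bsub>Rad A\<^esub> \<Squnion>\<^bsub>Rad A\<^esub>Y = \<Squnion>\<^bsub>Rad A\<^esub>((\<lambda>J. I \<sqinter>\<^bsub>Rad A\<^esub> J) ` Y)"
      using rI Y by (simp add: Y' Sup_Rad meet_Rad radical_prime_hull)
  qed
qed

end

section \<open>The spectrum and its open sets\<close>

text \<open>The Zariski open set D(S), for arbitrary \<open>S\<close>, so that a union of such sets
  is D of the union.\<close>

definition basic_open :: "('a, 'm) ord_ring_scheme \<Rightarrow> 'a set \<Rightarrow> 'a set set"
  where "basic_open A S = {P. prime_ord_ideal P A \<and> \<not> S \<subseteq> P}"

lemma Union_basic_open: "(\<Union>S\<in>\<S>. basic_open A S) = basic_open A (\<Union>\<S>)"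
  unfolding basic_open_def by blast

context ord_semiring
begin

text \<open>A prime contains \<open>S\<close> iff it contains the hull, so every D(S) is also D of a
  radical ideal.\<close>

lemma basic_open_prime_hull:
  assumes "S \<subseteq> carrier A"
  shows "basic_open A (prime_hull A S) = basic_open A S"
proof -
  have "prime_hull A S \<subseteq> P \<longleftrightarrow> S \<subseteq> P" if "prime_ord_ideal P A" for P
    using order_trans[OF prime_hull_superset[OF assms]] prime_hull_subset[OF that] by (rule iffI)
  then show ?thesis by (auto simp: basic_open_def)
qed

lemma basic_open_Int:
  assumes "radical_ord_ideal I A" "radical_ord_ideal J A"
  shows "basic_open A I \<inter> basic_open A J = basic_open A (I \<inter> J)"
proof -
  have "I \<inter> J \<subseteq> P \<longleftrightarrow> I \<subseteq> P \<or> J \<subseteq> P" if "prime_ord_ideal P A" for P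
    using prime_Int_subset[OF that, of I J] assms by (auto simp: radical_ord_ideal_def)
  then show ?thesis by (auto simp: basic_open_def)
qed

text \<open>An \<open>x\<close> in \<open>I\<close> but not in \<open>J\<close> would give a prime
  above \<open>J\<close> avoiding \<open>x\<close>: a point of D(I) outside D(J).\<close>

lemma basic_open_subset_iff:
  assumes "radical_ord_ideal I A" "radical_ord_ideal J A"
  shows "basic_open A I \<subseteq> basic_open A J \<longleftrightarrow> I \<subseteq> J"
proof
  assume sub: "basic_open A I \<subseteq> basic_open A J"
  show "I \<subseteq> J"
  proof
    fix x assume x: "x \<in> I"
    then have "x \<in> carrier A"
      using assms(1) ord_ideal.ideal_subset by (auto simp: radical_ord_ideal_def)
    then show "x \<in> J"
      using ex_prime_avoiding[OF assms(2), of x] sub x unfolding basic_open_def by blast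
  qed
qed (auto simp: basic_open_def)

text \<open>The sets D(I) with \<open>I\<close> radical already form a topology, so surjectivity of
  the isomorphism is built in.\<close>

definition spectrum :: "'a set topology"
  where "spectrum = topology (\<lambda>U. \<exists>I. radical_ord_ideal I A \<and> U = basic_open A I)"

lemma openin_spectrum:
  "openin spectrum U \<longleftrightarrow> (\<exists>I. radical_ord_ideal I A \<and> U = basic_open A I)"
proof -
  let ?opn = "\<lambda>U. \<exists>I. radical_ord_ideal I A \<and> U = basic_open A I"
  have "istopology ?opn"
    unfolding istopology_def
  proof (intro conjI allI impI)
    fix U V assume "?opn U" "?opn V"
    then show "?opn (U \<inter> V)"
      using basic_open_Int radical_ord_ideal_Int by metis
  next
    fix K assume K: "\<forall>U\<in>K. ?opn U"
    \<comment> \<open>All radical ideals that index members of \<open>K\<close> are collected, which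
      avoids choosing one for each open set; the hull of their union then indexes
      \<open>\<Union>K\<close>.\<close>
    let ?S = "{I. radical_ord_ideal I A \<and> basic_open A I \<in> K}"
    have "\<Union>K = (\<Union>I\<in>?S. basic_open A I)" using K by auto
    also have "\<dots> = basic_open A (\<Union>?S)" by (rule Union_basic_open)
    finally have "\<Union>K = basic_open A (\<Union>?S)" .
    moreover have "\<Union>?S \<subseteq> carrier A"
      by (auto simp: radical_ord_ideal_def dest: ord_ideal.ideal_subset)
    ultimately show "?opn (\<Union>K)"
      using basic_open_prime_hull radical_prime_hull by metis
  qed
  then show ?thesis by (simp add: spectrum_def)
qed

lemma basic_open_isomorphism: "order_isomorphism (Rad A) (opens spectrum) (basic_open A)"
  unfolding order_isomorphism_def
proof
  show "order_emb (Rad A) (opens spectrum) (basic_open A)"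
    unfolding order_emb_def
  proof (intro conjI ballI)
    show "weak_partial_order (Rad A)"
      using partial_order_Rad by (simp add: partial_order_def)
    show "weak_partial_order (opens spectrum)"
      by unfold_locales (auto simp: opens_def)
  qed (simp add: Rad_def opens_def basic_open_subset_iff)
  show "bij_betw (basic_open A) (carrier (Rad A)) (carrier (opens spectrum))"
  proof (rule bij_betw_imageI)
    show "inj_on (basic_open A) (carrier (Rad A))"
    proof (rule inj_onI)
      fix I J assume "I \<in> carrier (Rad A)" "J \<in> carrier (Rad A)" "basic_open A I = basic_open A J"
      then show "I = J"
        using basic_open_subset_iff[of I J] basic_open_subset_iff[of J I] by (simp add: Rad_def)
    qed
  qed (auto simp: Rad_def opens_def openin_spectrum)
qed

end

theorem mainTheorem6:
  fixes A :: "('a, 'm) ord_ring_scheme"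
  assumes "ord_semiring A"
  shows "spatial_frame (Rad A)"
proof -
  interpret ord_semiring A by fact
  show ?thesis
    using frame_Rad basic_open_isomorphism by (rule spatial_frameI)
qed

end
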